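(* Let $R$ be a commutative ring with identity and $S$ a multiplicative subset of $R$. Suppose $R$ is a $u$-$S$-semisimple ring. Then $R$ is a $u$-$S$-Artinian ring.
   Context: All rings are commutative with identity and all modules are unitary. A subset $S$ of $R$ is multiplicative if $1\in S$ and $s_1s_2\in S$ for all $s_1,s_2\in S$. A sequence $0\to A\xrightarrow{f}B\xrightarrow{g}C\to 0$ of $R$-modules is a short $u$-$S$-exact sequence if there is $s\in S$ such that $s\operatorname{Ker}(f)=0$, $s\operatorname{Coker}(g)=0$, $s\operatorname{Ker}(g)\subseteq\operatorname{Im}(f)$ and $s\operatorname{Im}(f)\subseteq\operatorname{Ker}(g)$. It is $u$-$S$-split if there exist $s\in S$ and an $R$-homomorphism $h:B\to A$ such that $h\circ f=s\,\mathrm{Id}_A$. An $R$-module $M$ is $u$-$S$-semisimple if every short $u$-$S$-exact sequence $0\to A\to M\to C\to 0$ is $u$-$S$-split. The ring $R$ is a $u$-$S$-semisimple ring if every free $R$-module is $u$-$S$-semisimple. The ring $R$ is $u$-$S$-Artinian if there exists $s\in S$ such that for every descending chain $I_1\supseteq I_2\supseteq\cdots$ of ideals of $R$ there is $k\in\mathbb{Z}^{+}$ with $sI_k\subseteq I_n$ for all $n\geq k$. *)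

theory Defs
  imports "HOL-Algebra.Module" "HOL-Algebra.Ideal"
begin

section \<open>Module homomorphisms, quotient modules, free modules\<close>

definition module_hom ::
  "('a, 'r) ring_scheme \<Rightarrow> ('a, 'b, 'm) module_scheme \<Rightarrow> ('a, 'c, 'n) module_scheme \<Rightarrow> ('b \<Rightarrow> 'c) set"
  where "module_hom R M N =
    {f \<in> carrier M \<rightarrow> carrier N.
       (\<forall>x\<in>carrier M. \<forall>y\<in>carrier M. f (x \<oplus>\<^bsub>M\<^esub> y) = f x \<oplus>\<^bsub>N\<^esub> f y) \<and>
       (\<forall>a\<in>carrier R. \<forall>x\<in>carrier M. f (a \<odot>\<^bsub>M\<^esub> x) = a \<odot>\<^bsub>N\<^esub> f x)}"

text \<open>The elements of \<open>M/N\<close> are the cosets \<open>N + x\<close>.  The pointwise multiple \<open>a(N + x)\<close> is in general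
  only a subset of the coset \<open>N + ax\<close>, hence the added \<open>N\<close> in the scalar multiplication.
  The fields \<open>mult\<close> and \<open>one\<close>, inherited from the ring record, play no role in a module.\<close>

definition quot_module :: "('a, 'b, 'm) module_scheme \<Rightarrow> 'b set \<Rightarrow> ('a, 'b set) module"
  where "quot_module M N =
    \<lparr>carrier = a_rcosets\<^bsub>M\<^esub> N, mult = undefined, one = undefined,
     zero = N, add = (\<lambda>X Y. X <+>\<^bsub>M\<^esub> Y),
     smult = (\<lambda>a X. N <+>\<^bsub>M\<^esub> ((\<lambda>x. a \<odot>\<^bsub>M\<^esub> x) ` X))\<rparr>"

definition coker ::
  "('a, 'b, 'm) module_scheme \<Rightarrow> ('a, 'c, 'n) module_scheme \<Rightarrow> ('b \<Rightarrow> 'c) \<Rightarrow> ('a, 'c set) module"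
  where "coker M N f = quot_module N (f ` carrier M)"

definition is_basis :: "('a, 'r) ring_scheme \<Rightarrow> ('a, 'b, 'm) module_scheme \<Rightarrow> 'b set \<Rightarrow> bool"
  where "is_basis R M B \<longleftrightarrow> B \<subseteq> carrier M \<and>
    (\<forall>x\<in>carrier M. \<exists>!c. c \<in> B \<rightarrow> carrier R \<and> (\<forall>b. b \<notin> B \<longrightarrow> c b = \<zero>\<^bsub>R\<^esub>) \<and>
       finite {b. c b \<noteq> \<zero>\<^bsub>R\<^esub>} \<and> x = (\<Oplus>\<^bsub>M\<^esub>b\<in>{b. c b \<noteq> \<zero>\<^bsub>R\<^esub>}. c b \<odot>\<^bsub>M\<^esub> b))"

definition free_module :: "('a, 'r) ring_scheme \<Rightarrow> ('a, 'b, 'm) module_scheme \<Rightarrow> bool"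
  where "free_module R M \<longleftrightarrow> module R M \<and> (\<exists>B. is_basis R M B)"


section \<open>The uniform notions relative to a multiplicative set\<close>

text \<open>A multiplicative subset \<open>S\<close> of \<open>R\<close> is expressed by \<^term>\<open>submonoid S R\<close>.\<close>

definition uS_short_exact ::
  "('a, 'r) ring_scheme \<Rightarrow> 'a set \<Rightarrow> ('a, 'b, 'k) module_scheme \<Rightarrow> ('b \<Rightarrow> 'c) \<Rightarrow>
   ('a, 'c, 'm) module_scheme \<Rightarrow> ('c \<Rightarrow> 'd) \<Rightarrow> ('a, 'd, 'n) module_scheme \<Rightarrow> bool"
  where "uS_short_exact R S A f B g C \<longleftrightarrow>
    module R A \<and> module R B \<and> module R C \<and> f \<in> module_hom R A B \<and> g \<in> module_hom R B C \<and>
    (\<exists>s\<in>S. (\<forall>x\<in>a_kernel A B f. s \<odot>\<^bsub>A\<^esub> x = \<zero>\<^bsub>A\<^esub>) \<and>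
           (\<forall>X\<in>carrier (coker B C g). s \<odot>\<^bsub>coker B C g\<^esub> X = \<zero>\<^bsub>coker B C g\<^esub>) \<and>
           (\<lambda>y. s \<odot>\<^bsub>B\<^esub> y) ` a_kernel B C g \<subseteq> f ` carrier A \<and>
           (\<lambda>y. s \<odot>\<^bsub>B\<^esub> y) ` (f ` carrier A) \<subseteq> a_kernel B C g)"

text \<open>Being split depends on the first map \<open>f : A \<rightarrow> B\<close> of the sequence only.\<close>

definition uS_split ::
  "('a, 'r) ring_scheme \<Rightarrow> 'a set \<Rightarrow> ('a, 'b, 'k) module_scheme \<Rightarrow> ('b \<Rightarrow> 'c) \<Rightarrow>
   ('a, 'c, 'm) module_scheme \<Rightarrow> bool"
  where "uS_split R S A f B \<longleftrightarrow>
    (\<exists>s\<in>S. \<exists>h\<in>module_hom R B A. \<forall>x\<in>carrier A. h (f x) = s \<odot>\<^bsub>A\<^esub> x)"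

text \<open>A definition cannot quantify over types, so the outer modules are taken with carriers in the
  types of \<open>M\<close> and of its quotients.  This loses nothing: \<open>uS_semisimple_imp_split\<close> below shows that then
  every short sequence with middle term \<open>M\<close>, whatever the types of \<open>A\<close> and \<open>C\<close>, splits.\<close>

definition uS_semisimple :: "('a, 'r) ring_scheme \<Rightarrow> 'a set \<Rightarrow> ('a, 'm) module \<Rightarrow> bool"
  where "uS_semisimple R S M \<longleftrightarrow> module R M \<and>
    (\<forall>(A :: ('a, 'm) module) f g (C :: ('a, 'm set) module).
       uS_short_exact R S A f M g C \<longrightarrow> uS_split R S A f M)"

text \<open>For the same reason the class of all free modules is represented by those with carrier in
  a type \<open>'m\<close>.  The property at \<open>'m\<close> gives semisimplicity of every free module, of any type, whose
  carrier embeds into \<open>'m\<close> (\<open>uS_semisimple_ring_imp_free\<close> below); thus the property becomes stronger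
  as \<open>'m\<close> grows, and as a hypothesis it is weakest for small \<open>'m\<close>.  For \<open>'m = 'a set \<Rightarrow> 'a\<close>, where \<open>'a\<close> is the type of the
  elements of \<open>R\<close>, the class contains the module of finitely supported families indexed by any set
  of subsets of \<open>R\<close>, so the rank may be infinite, up to the number of subsets of \<open>R\<close>.\<close>

definition uS_semisimple_ring :: "'m itself \<Rightarrow> ('a, 'r) ring_scheme \<Rightarrow> 'a set \<Rightarrow> bool"
  where "uS_semisimple_ring (_ :: 'm itself) R S \<longleftrightarrow>
    (\<forall>M :: ('a, 'm) module. free_module R M \<longrightarrow> uS_semisimple R S M)"

definition uS_Artinian :: "('a, 'r) ring_scheme \<Rightarrow> 'a set \<Rightarrow> bool"
  where "uS_Artinian R S \<longleftrightarrow>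
    (\<exists>s\<in>S. \<forall>I :: nat \<Rightarrow> 'a set.
       (\<forall>n. ideal (I n) R \<and> I (Suc n) \<subseteq> I n) \<longrightarrow>
       (\<exists>k. \<forall>n\<ge>k. (\<lambda>x. s \<otimes>\<^bsub>R\<^esub> x) ` I k \<subseteq> I n))"


section \<open>Independence of the chosen types\<close>

lemma module_homD:
  assumes "f \<in> module_hom R M N"
  shows "x \<in> carrier M \<Longrightarrow> f x \<in> carrier N"
    and "x \<in> carrier M \<Longrightarrow> y \<in> carrier M \<Longrightarrow> f (x \<oplus>\<^bsub>M\<^esub> y) = f x \<oplus>\<^bsub>N\<^esub> f y"
    and "a \<in> carrier R \<Longrightarrow> x \<in> carrier M \<Longrightarrow> f (a \<odot>\<^bsub>M\<^esub> x) = a \<odot>\<^bsub>N\<^esub> f x"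
  using assms by (auto simp: module_hom_def)

lemma module_hom_abelian_group_hom:
  assumes "module R M" "module R N" "f \<in> module_hom R M N"
  shows "abelian_group_hom M N f"
proof -
  interpret M: module R M by fact
  interpret N: module R N by fact
  show ?thesis
    by (intro abelian_group_homI M.abelian_group_axioms N.abelian_group_axioms)
       (auto simp: group_hom_def group_hom_axioms_def hom_def module_homD[OF assms(3)]
             intro: M.a_group N.a_group)
qed

context module
begin

lemma submodule_abelian_subgroup:
  assumes "submodule N R M"
  shows "abelian_subgroup N M"
proof -
  interpret submodule N R M by fact
  show ?thesis
    by (intro abelian_subgroupI3 additive_subgroup.intro M.abelian_group_axioms)
       (rule subgroup_axioms)
qed

lemma submodule_zero:
  assumes "submodule N R M"
  shows "\<zero>\<^bsub>M\<^esub> \<in> N"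
proof -
  interpret abelian_subgroup N M using assms by (rule submodule_abelian_subgroup)
  show ?thesis by simp
qed

lemma quot_smult_coset:
  assumes N: "submodule N R M" and a: "a \<in> carrier R" and x: "x \<in> carrier M"
  shows "a \<odot>\<^bsub>quot_module M N\<^esub> (N +>\<^bsub>M\<^esub> x) = N +>\<^bsub>M\<^esub> (a \<odot>\<^bsub>M\<^esub> x)"
proof -
  note sub = submoduleE[OF N]
  have "N <+>\<^bsub>M\<^esub> ((\<lambda>x. a \<odot>\<^bsub>M\<^esub> x) ` (N +>\<^bsub>M\<^esub> x)) = N +>\<^bsub>M\<^esub> (a \<odot>\<^bsub>M\<^esub> x)"
  proof (intro equalityI subsetI)
    fix z assume "z \<in> N <+>\<^bsub>M\<^esub> ((\<lambda>x. a \<odot>\<^bsub>M\<^esub> x) ` (N +>\<^bsub>M\<^esub> x))"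
    then obtain n n' where n: "n \<in> N" "n' \<in> N" and z: "z = n \<oplus>\<^bsub>M\<^esub> a \<odot>\<^bsub>M\<^esub> (n' \<oplus>\<^bsub>M\<^esub> x)"
      by (auto simp: set_add_def' a_r_coset_def')
    have c: "n \<in> carrier M" "n' \<in> carrier M" using n sub(1) by auto
    have "z = (n \<oplus>\<^bsub>M\<^esub> a \<odot>\<^bsub>M\<^esub> n') \<oplus>\<^bsub>M\<^esub> a \<odot>\<^bsub>M\<^esub> x"
      using c a x by (simp add: z smult_r_distr M.a_assoc)
    moreover have "n \<oplus>\<^bsub>M\<^esub> a \<odot>\<^bsub>M\<^esub> n' \<in> N" using n a sub by blast
    ultimately show "z \<in> N +>\<^bsub>M\<^esub> (a \<odot>\<^bsub>M\<^esub> x)" by (auto simp: a_r_coset_def')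
  next
    fix z assume "z \<in> N +>\<^bsub>M\<^esub> (a \<odot>\<^bsub>M\<^esub> x)"
    then obtain n where n: "n \<in> N" and z: "z = n \<oplus>\<^bsub>M\<^esub> a \<odot>\<^bsub>M\<^esub> x" by (auto simp: a_r_coset_def')
    have "x = \<zero>\<^bsub>M\<^esub> \<oplus>\<^bsub>M\<^esub> x" using x by simp
    hence "x \<in> N +>\<^bsub>M\<^esub> x" using submodule_zero[OF N] by (auto simp: a_r_coset_def')
    thus "z \<in> N <+>\<^bsub>M\<^esub> ((\<lambda>x. a \<odot>\<^bsub>M\<^esub> x) ` (N +>\<^bsub>M\<^esub> x))" using n z by (auto simp: set_add_def')
  qed
  thus ?thesis by (simp add: quot_module_def)
qed

lemma quot_carrier: "carrier (quot_module M N) = (\<lambda>x. N +>\<^bsub>M\<^esub> x) ` carrier M"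
  by (auto simp: quot_module_def A_RCOSETS_def')

lemma quot_add_coset:
  assumes N: "submodule N R M" and "x \<in> carrier M" "y \<in> carrier M"
  shows "(N +>\<^bsub>M\<^esub> x) \<oplus>\<^bsub>quot_module M N\<^esub> (N +>\<^bsub>M\<^esub> y) = N +>\<^bsub>M\<^esub> (x \<oplus>\<^bsub>M\<^esub> y)"
proof -
  interpret abelian_subgroup N M using N by (rule submodule_abelian_subgroup)
  show ?thesis using assms by (simp add: quot_module_def a_rcos_sum)
qed

lemma quot_zero: "\<zero>\<^bsub>quot_module M N\<^esub> = N"
  by (simp add: quot_module_def)

lemma coset_eq_iff:
  assumes N: "submodule N R M" and "x \<in> carrier M"
  shows "N +>\<^bsub>M\<^esub> x = N \<longleftrightarrow> x \<in> N"
proof -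
  interpret abelian_subgroup N M using N by (rule submodule_abelian_subgroup)
  show ?thesis using assms a_rcos_self a_rcos_const by auto
qed

lemma module_quot:
  assumes N: "submodule N R M"
  shows "module R (quot_module M N)"
proof -
  interpret abelian_subgroup N M using N by (rule submodule_abelian_subgroup)
  have z: "N = N +>\<^bsub>M\<^esub> \<zero>\<^bsub>M\<^esub>" using coset_eq_iff[OF N, of "\<zero>\<^bsub>M\<^esub>"] by simp
  have zz: "\<zero>\<^bsub>quot_module M N\<^esub> = N +>\<^bsub>M\<^esub> \<zero>\<^bsub>M\<^esub>" using z by (simp add: quot_zero)
  note simps = quot_carrier quot_add_coset[OF N] quot_smult_coset[OF N]
  show ?thesis
  proof (intro moduleI abelian_groupI)
    show "cring R" ..
    show "\<zero>\<^bsub>quot_module M N\<^esub> \<in> carrier (quot_module M N)"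
      unfolding zz by (auto simp: quot_carrier)
    fix X assume "X \<in> carrier (quot_module M N)"
    then obtain x where x: "x \<in> carrier M" "X = N +>\<^bsub>M\<^esub> x" by (auto simp: quot_carrier)
    show "\<zero>\<^bsub>quot_module M N\<^esub> \<oplus>\<^bsub>quot_module M N\<^esub> X = X"
      unfolding zz using x by (simp add: simps)
    show "\<exists>y\<in>carrier (quot_module M N). y \<oplus>\<^bsub>quot_module M N\<^esub> X = \<zero>\<^bsub>quot_module M N\<^esub>"
      unfolding zz using x
      by (intro bexI[of _ "N +>\<^bsub>M\<^esub> (\<ominus>\<^bsub>M\<^esub> x)"]) (auto simp: simps M.l_neg)
  qed (auto simp: simps smult_l_distr smult_r_distr smult_assoc1 M.a_ac)
qed

lemma quot_map_hom:
  assumes N: "submodule N R M"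
  shows "(\<lambda>x. N +>\<^bsub>M\<^esub> x) \<in> module_hom R M (quot_module M N)"
  by (auto simp: module_hom_def quot_carrier quot_add_coset[OF N] quot_smult_coset[OF N])

lemma image_submodule:
  assumes A: "module R A" and f: "f \<in> module_hom R A M"
  shows "submodule (f ` carrier A) R M"
proof -
  interpret A: module R A by fact
  interpret f: abelian_group_hom A M f
    using A module_axioms f by (rule module_hom_abelian_group_hom)
  show ?thesis
  proof (rule submoduleI)
    show "\<zero>\<^bsub>M\<^esub> \<in> f ` carrier A" using f.hom_zero by (metis A.M.zero_closed image_eqI)
    show "\<ominus>\<^bsub>M\<^esub> a \<in> f ` carrier A" if "a \<in> f ` carrier A" for a
      using that f.a_inv_closed by (metis (no_types, lifting) A.M.a_inv_closed f.hom_a_inv image_iff)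
    show "a \<oplus>\<^bsub>M\<^esub> b \<in> f ` carrier A" if "a \<in> f ` carrier A" "b \<in> f ` carrier A" for a b
      using that module_homD(2)[OF f] by (metis (no_types, lifting) A.M.a_closed image_iff)
    show "a \<odot>\<^bsub>M\<^esub> x \<in> f ` carrier A" if "a \<in> carrier R" "x \<in> f ` carrier A" for a x
      using that module_homD(3)[OF f] by (metis (no_types, lifting) A.smult_closed image_iff)
  qed (use module_homD(1)[OF f] in auto)
qed

text \<open>The cokernel condition in elementary terms.\<close>

lemma coker_annihilated_iff:
  assumes A: "module R A" and f: "f \<in> module_hom R A M" and s: "s \<in> carrier R"
  shows "(\<forall>X\<in>carrier (coker A M f). s \<odot>\<^bsub>coker A M f\<^esub> X = \<zero>\<^bsub>coker A M f\<^esub>) \<longleftrightarrow>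
         (\<lambda>x. s \<odot>\<^bsub>M\<^esub> x) ` carrier M \<subseteq> f ` carrier A"
  using quot_smult_coset[OF image_submodule[OF A f] s] coset_eq_iff[OF image_submodule[OF A f]] s
  by (auto simp: coker_def quot_carrier quot_zero)

end

theorem uS_semisimple_imp_split:
  fixes A :: "('a, 'x, 'k) module_scheme" and C :: "('a, 'y, 'n) module_scheme"
  assumes S: "submonoid S R" and M: "uS_semisimple R S M" and ex: "uS_short_exact R S A f M g C"
  shows "uS_split R S A f M"
proof -
  interpret A: module R A using ex by (simp add: uS_short_exact_def)
  interpret M: module R M using ex by (simp add: uS_short_exact_def)
  have f: "f \<in> module_hom R A M" using ex by (simp add: uS_short_exact_def)
  interpret f: abelian_group_hom A M f
    using A.module_axioms M.module_axioms f by (rule module_hom_abelian_group_hom)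
  obtain t where tS: "t \<in> S" and t: "\<And>x. x \<in> a_kernel A M f \<Longrightarrow> t \<odot>\<^bsub>A\<^esub> x = \<zero>\<^bsub>A\<^esub>"
    using ex by (auto simp: uS_short_exact_def)
  have SR: "S \<subseteq> carrier R" "\<one>\<^bsub>R\<^esub> \<in> S" using S by (auto simp: submonoid_def)
  have tR: "t \<in> carrier R" using tS SR by auto
  define N where "N = f ` carrier A"
  have N: "submodule N R M" unfolding N_def by (rule M.image_submodule[OF A.module_axioms f])
  let ?N = "M\<lparr>carrier := N\<rparr>"
  have modN: "module R ?N" by (rule submodule.submodule_is_module[OF N M.module_axioms])
  have NM: "N \<subseteq> carrier M" using M.submoduleE(1)[OF N] .
  have "uS_short_exact R S ?N (\<lambda>x. x) M (\<lambda>x. N +>\<^bsub>M\<^esub> x) (quot_module M N)"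
    unfolding uS_short_exact_def
  proof (intro conjI bexI)
    show "\<one>\<^bsub>R\<^esub> \<in> S" by (rule SR)
    show "(\<lambda>x. x) \<in> module_hom R ?N M" using NM by (auto simp: module_hom_def)
    show pi: "(\<lambda>x. N +>\<^bsub>M\<^esub> x) \<in> module_hom R M (quot_module M N)" by (rule M.quot_map_hom[OF N])
    interpret Q: module R "quot_module M N" by (rule M.module_quot[OF N])
    show "\<forall>x\<in>a_kernel ?N M (\<lambda>x. x). \<one>\<^bsub>R\<^esub> \<odot>\<^bsub>?N\<^esub> x = \<zero>\<^bsub>?N\<^esub>"
      by (auto simp: a_kernel_def')
    show "\<forall>X\<in>carrier (coker M (quot_module M N) (\<lambda>x. N +>\<^bsub>M\<^esub> x)).
      \<one>\<^bsub>R\<^esub> \<odot>\<^bsub>coker M (quot_module M N) (\<lambda>x. N +>\<^bsub>M\<^esub> x)\<^esub> X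
        = \<zero>\<^bsub>coker M (quot_module M N) (\<lambda>x. N +>\<^bsub>M\<^esub> x)\<^esub>"
      unfolding Q.coker_annihilated_iff[OF M.module_axioms pi A.R.one_closed]
      by (simp only: M.quot_carrier[symmetric]) (simp add: image_subset_iff)
    have "a_kernel M (quot_module M N) (\<lambda>x. N +>\<^bsub>M\<^esub> x) = N"
      using NM M.coset_eq_iff[OF N] by (auto simp: a_kernel_def' M.quot_zero)
    thus "(\<lambda>y. \<one>\<^bsub>R\<^esub> \<odot>\<^bsub>M\<^esub> y) ` a_kernel M (quot_module M N) (\<lambda>x. N +>\<^bsub>M\<^esub> x) \<subseteq> (\<lambda>x. x) ` carrier ?N"
      and "(\<lambda>y. \<one>\<^bsub>R\<^esub> \<odot>\<^bsub>M\<^esub> y) ` ((\<lambda>x. x) ` carrier ?N) \<subseteq> a_kernel M (quot_module M N) (\<lambda>x. N +>\<^bsub>M\<^esub> x)"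
      using NM by auto
  qed (rule modN M.module_axioms M.module_quot[OF N])+
  hence "uS_split R S ?N (\<lambda>x. x) M" using M unfolding uS_semisimple_def by blast
  then obtain s h where sS: "s \<in> S" and h: "h \<in> module_hom R M ?N"
    and hs: "\<And>x. x \<in> N \<Longrightarrow> h x = s \<odot>\<^bsub>M\<^esub> x"
    unfolding uS_split_def by (simp add: N_def) blast
  have sR: "s \<in> carrier R" using sS SR by auto
  define p where "p y = (SOME x. x \<in> carrier A \<and> f x = y)" for y
  have p: "p y \<in> carrier A \<and> f (p y) = y" if "y \<in> N" for y
  proof -
    have "\<exists>x. x \<in> carrier A \<and> f x = y" using that by (auto simp: N_def)
    then show ?thesis unfolding p_def by (rule someI_ex)
  qed
  have eq: "t \<odot>\<^bsub>A\<^esub> x = t \<odot>\<^bsub>A\<^esub> y" if "x \<in> carrier A" "y \<in> carrier A" "f x = f y" for x y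
  proof -
    have "f (x \<oplus>\<^bsub>A\<^esub> \<ominus>\<^bsub>A\<^esub> y) = \<zero>\<^bsub>M\<^esub>" using that by (simp add: M.M.r_neg)
    hence "x \<oplus>\<^bsub>A\<^esub> \<ominus>\<^bsub>A\<^esub> y \<in> a_kernel A M f" using that by (simp add: a_kernel_def')
    hence "t \<odot>\<^bsub>A\<^esub> (x \<oplus>\<^bsub>A\<^esub> \<ominus>\<^bsub>A\<^esub> y) = \<zero>\<^bsub>A\<^esub>" by (rule t)
    hence "t \<odot>\<^bsub>A\<^esub> x \<oplus>\<^bsub>A\<^esub> \<ominus>\<^bsub>A\<^esub> (t \<odot>\<^bsub>A\<^esub> y) = \<zero>\<^bsub>A\<^esub>"
      using that tR by (simp add: A.smult_r_distr A.smult_r_minus)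
    thus ?thesis using that tR
      by (metis A.M.add.inv_closed A.M.minus_equality A.M.minus_minus A.smult_closed)
  qed
  define k where "k y = t \<odot>\<^bsub>A\<^esub> p y" for y
  have kf: "k (f x) = t \<odot>\<^bsub>A\<^esub> x" if "x \<in> carrier A" for x
    unfolding k_def using that p[of "f x"] by (intro eq) (auto simp: N_def)
  have hN: "h x \<in> N" if "x \<in> carrier M" for x using module_homD(1)[OF h that] by simp
  have "(\<lambda>x. k (h x)) \<in> module_hom R M A"
    unfolding module_hom_def
  proof (intro CollectI conjI ballI funcsetI)
    fix x y assume xy: "x \<in> carrier M" "y \<in> carrier M"
    obtain a b where ab: "a \<in> carrier A" "b \<in> carrier A" "h x = f a" "h y = f b"
      using hN[OF xy(1)] hN[OF xy(2)] by (auto simp: N_def)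
    have "h (x \<oplus>\<^bsub>M\<^esub> y) = f (a \<oplus>\<^bsub>A\<^esub> b)" using module_homD(2)[OF h xy] ab by simp
    thus "k (h (x \<oplus>\<^bsub>M\<^esub> y)) = k (h x) \<oplus>\<^bsub>A\<^esub> k (h y)"
      using ab tR by (simp add: kf A.smult_r_distr del: f.hom_add)
  next
    fix r x assume rx: "r \<in> carrier R" "x \<in> carrier M"
    obtain a where a: "a \<in> carrier A" "h x = f a"
      using hN[OF rx(2)] by (auto simp: N_def)
    have "h (r \<odot>\<^bsub>M\<^esub> x) = f (r \<odot>\<^bsub>A\<^esub> a)"
      using module_homD(3)[OF h rx] module_homD(3)[OF f rx(1) a(1)] a by simp
    thus "k (h (r \<odot>\<^bsub>M\<^esub> x)) = r \<odot>\<^bsub>A\<^esub> k (h x)"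
      using a rx tR by (simp add: kf A.smult_assoc1[symmetric] A.R.m_comm)
  next
    fix x assume "x \<in> carrier M"
    thus "k (h x) \<in> carrier A" using p hN tR by (auto simp: k_def)
  qed
  moreover have "k (h (f x)) = (t \<otimes>\<^bsub>R\<^esub> s) \<odot>\<^bsub>A\<^esub> x" if x: "x \<in> carrier A" for x
  proof -
    have "h (f x) = f (s \<odot>\<^bsub>A\<^esub> x)"
      using hs[of "f x"] x module_homD(3)[OF f sR x] by (auto simp: N_def)
    thus ?thesis using x sR tR by (simp add: kf A.smult_assoc1)
  qed
  moreover have "t \<otimes>\<^bsub>R\<^esub> s \<in> S" using S sS tS by (auto simp: submonoid_def)
  ultimately show ?thesis unfolding uS_split_def by (intro bexI[of _ "t \<otimes>\<^bsub>R\<^esub> s"] bexI[of _ "\<lambda>x. k (h x)"]) auto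
qed

lemma module_hom_finsum:
  assumes M: "module R M" and N: "module R N" and f: "f \<in> module_hom R M N"
    and F: "finite F" "g \<in> F \<rightarrow> carrier M"
  shows "f (\<Oplus>\<^bsub>M\<^esub>i\<in>F. g i) = (\<Oplus>\<^bsub>N\<^esub>i\<in>F. f (g i))"
  using F
proof (induction F)
  interpret M: module R M by fact
  interpret N: module R N by fact
  interpret f: abelian_group_hom M N f using M N f by (rule module_hom_abelian_group_hom)
  case empty
  then show ?case by simp
next
  interpret M: module R M by fact
  interpret N: module R N by fact
  interpret f: abelian_group_hom M N f using M N f by (rule module_hom_abelian_group_hom)
  case (insert x F)
  moreover have "(\<lambda>i. f (g i)) \<in> F \<rightarrow> carrier N" "f (g x) \<in> carrier N"
    using insert module_homD(1)[OF f] by (auto simp: Pi_def)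
  ultimately show ?case by (simp add: Pi_def)
qed

lemma free_module_transfer:
  assumes M: "module R M" and N: "module R N" and i: "i \<in> module_hom R M N"
    and bij: "bij_betw i (carrier M) (carrier N)" and free: "free_module R M"
  shows "free_module R N"
proof -
  interpret M: module R M by fact
  interpret N: module R N by fact
  obtain B where B: "B \<subseteq> carrier M"
    and ex1: "\<And>x. x \<in> carrier M \<Longrightarrow> \<exists>!c. c \<in> B \<rightarrow> carrier R \<and> (\<forall>b. b \<notin> B \<longrightarrow> c b = \<zero>\<^bsub>R\<^esub>) \<and>
       finite {b. c b \<noteq> \<zero>\<^bsub>R\<^esub>} \<and> x = (\<Oplus>\<^bsub>M\<^esub>b\<in>{b. c b \<noteq> \<zero>\<^bsub>R\<^esub>}. c b \<odot>\<^bsub>M\<^esub> b)"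
    using free by (auto simp: free_module_def is_basis_def)
  have inj: "inj_on i (carrier M)" and im: "i ` carrier M = carrier N"
    using bij by (auto simp: bij_betw_def)
  have injB: "inj_on i B" using inj B by (rule inj_on_subset)
  define pull where "pull c b = (if b \<in> B then c (i b) else \<zero>\<^bsub>R\<^esub>)" for c b
  define push where "push c u = (if u \<in> i ` B then c (inv_into B i u) else \<zero>\<^bsub>R\<^esub>)" for c u
  define P where "P c x \<longleftrightarrow> c \<in> B \<rightarrow> carrier R \<and> (\<forall>b. b \<notin> B \<longrightarrow> c b = \<zero>\<^bsub>R\<^esub>) \<and>
       finite {b. c b \<noteq> \<zero>\<^bsub>R\<^esub>} \<and> x = (\<Oplus>\<^bsub>M\<^esub>b\<in>{b. c b \<noteq> \<zero>\<^bsub>R\<^esub>}. c b \<odot>\<^bsub>M\<^esub> b)" for c x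
  define Q where "Q c u \<longleftrightarrow> c \<in> i ` B \<rightarrow> carrier R \<and> (\<forall>b. b \<notin> i ` B \<longrightarrow> c b = \<zero>\<^bsub>R\<^esub>) \<and>
       finite {b. c b \<noteq> \<zero>\<^bsub>R\<^esub>} \<and> u = (\<Oplus>\<^bsub>N\<^esub>b\<in>{b. c b \<noteq> \<zero>\<^bsub>R\<^esub>}. c b \<odot>\<^bsub>N\<^esub> b)" for c u
  have Q_iff: "Q c (i x) \<longleftrightarrow> P (pull c) x"
    if c: "\<And>b. b \<notin> i ` B \<Longrightarrow> c b = \<zero>\<^bsub>R\<^esub>" and x: "x \<in> carrier M" for c x
  proof -
    let ?F = "{b. pull c b \<noteq> \<zero>\<^bsub>R\<^esub>}"
    have FB: "?F \<subseteq> B" by (auto simp: pull_def)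
    have supp: "{b. c b \<noteq> \<zero>\<^bsub>R\<^esub>} = i ` ?F"
      using c by (force simp: pull_def)
    have injF: "inj_on i ?F" using injB FB by (rule inj_on_subset)
    have fin: "finite {b. c b \<noteq> \<zero>\<^bsub>R\<^esub>} \<longleftrightarrow> finite ?F"
      unfolding supp using injF by (rule finite_image_iff)
    have cl: "c \<in> i ` B \<rightarrow> carrier R \<longleftrightarrow> pull c \<in> B \<rightarrow> carrier R"
      by (auto simp: pull_def Pi_def)
    have key: "i (\<Oplus>\<^bsub>M\<^esub>b\<in>?F. pull c b \<odot>\<^bsub>M\<^esub> b) = (\<Oplus>\<^bsub>N\<^esub>b\<in>{b. c b \<noteq> \<zero>\<^bsub>R\<^esub>}. c b \<odot>\<^bsub>N\<^esub> b)
      \<and> (\<Oplus>\<^bsub>M\<^esub>b\<in>?F. pull c b \<odot>\<^bsub>M\<^esub> b) \<in> carrier M"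
      if *: "finite ?F" "pull c \<in> B \<rightarrow> carrier R"
    proof
      have cR: "c (i b) \<in> carrier R" if "b \<in> ?F" for b
      proof -
        have "b \<in> B" using that FB by blast
        moreover have "pull c b = c (i b)" using \<open>b \<in> B\<close> by (simp add: pull_def)
        ultimately show ?thesis using funcset_mem[OF *(2)] by metis
      qed
      have iN: "i b \<in> carrier N" if "b \<in> ?F" for b
        using that FB B module_homD(1)[OF i] by blast
      have g: "(\<lambda>b. pull c b \<odot>\<^bsub>M\<^esub> b) \<in> ?F \<rightarrow> carrier M"
        using * FB B by (auto simp: Pi_def)
      then show "(\<Oplus>\<^bsub>M\<^esub>b\<in>?F. pull c b \<odot>\<^bsub>M\<^esub> b) \<in> carrier M" by (rule M.finsum_closed)
      have "i (\<Oplus>\<^bsub>M\<^esub>b\<in>?F. pull c b \<odot>\<^bsub>M\<^esub> b) = (\<Oplus>\<^bsub>N\<^esub>b\<in>?F. i (pull c b \<odot>\<^bsub>M\<^esub> b))"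
        by (rule module_hom_finsum[OF M N i *(1) g])
      also have "\<dots> = (\<Oplus>\<^bsub>N\<^esub>b\<in>?F. c (i b) \<odot>\<^bsub>N\<^esub> i b)"
      proof (rule N.finsum_cong'[OF refl])
        show "(\<lambda>b. c (i b) \<odot>\<^bsub>N\<^esub> i b) \<in> ?F \<rightarrow> carrier N"
          by (intro funcsetI N.smult_closed cR iN)
        fix b assume b: "b \<in> ?F"
        have "b \<in> B" using b FB by blast
        moreover from this have "pull c b = c (i b)" by (simp add: pull_def)
        moreover have "c (i b) \<in> carrier R" using b by (rule cR)
        ultimately show "i (pull c b \<odot>\<^bsub>M\<^esub> b) = c (i b) \<odot>\<^bsub>N\<^esub> i b"
          using module_homD(3)[OF i] B by auto
      qed
      also have "\<dots> = (\<Oplus>\<^bsub>N\<^esub>b\<in>i ` ?F. c b \<odot>\<^bsub>N\<^esub> b)"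
      proof (rule N.finsum_reindex[symmetric, OF _ injF])
        show "(\<lambda>b. c b \<odot>\<^bsub>N\<^esub> b) \<in> i ` ?F \<rightarrow> carrier N"
          by (intro funcsetI, elim imageE, hypsubst, intro N.smult_closed cR iN)
      qed
      finally show "i (\<Oplus>\<^bsub>M\<^esub>b\<in>?F. pull c b \<odot>\<^bsub>M\<^esub> b) = (\<Oplus>\<^bsub>N\<^esub>b\<in>{b. c b \<noteq> \<zero>\<^bsub>R\<^esub>}. c b \<odot>\<^bsub>N\<^esub> b)"
        by (simp add: supp)
    qed
    have sum: "i x = (\<Oplus>\<^bsub>N\<^esub>b\<in>{b. c b \<noteq> \<zero>\<^bsub>R\<^esub>}. c b \<odot>\<^bsub>N\<^esub> b) \<longleftrightarrow>
        x = (\<Oplus>\<^bsub>M\<^esub>b\<in>?F. pull c b \<odot>\<^bsub>M\<^esub> b)" if "finite ?F" "pull c \<in> B \<rightarrow> carrier R"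
      using inj_on_eq_iff[OF inj x conjunct2[OF key[OF that]]]
      unfolding conjunct1[OF key[OF that]] .
    have p0: "\<forall>b. b \<notin> B \<longrightarrow> pull c b = \<zero>\<^bsub>R\<^esub>" by (simp add: pull_def)
    have c0: "\<forall>b. b \<notin> i ` B \<longrightarrow> c b = \<zero>\<^bsub>R\<^esub>" using c by blast
    have "finite ?F \<longrightarrow> pull c \<in> B \<rightarrow> carrier R \<longrightarrow>
        (i x = (\<Oplus>\<^bsub>N\<^esub>b\<in>{b. c b \<noteq> \<zero>\<^bsub>R\<^esub>}. c b \<odot>\<^bsub>N\<^esub> b) \<longleftrightarrow>
         x = (\<Oplus>\<^bsub>M\<^esub>b\<in>?F. pull c b \<odot>\<^bsub>M\<^esub> b))"
      by (intro impI sum)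
    then show ?thesis
      unfolding Q_def P_def fin cl eqTrueI[OF p0] eqTrueI[OF c0] by satx
  qed
  have "\<exists>!c. Q c u" if u: "u \<in> carrier N" for u
  proof -
    obtain x where x: "x \<in> carrier M" "u = i x" using u unfolding im[symmetric] by blast
    have "\<exists>!c. P c x" using ex1[OF x(1)] by (simp add: P_def)
    then obtain c where c: "P c x" and uniq: "\<And>d. P d x \<Longrightarrow> d = c" by blast
    have "pull (push c) = c"
      using c injB by (auto simp: pull_def push_def P_def)
    moreover have push0: "\<And>b. b \<notin> i ` B \<Longrightarrow> push c b = \<zero>\<^bsub>R\<^esub>" by (simp add: push_def)
    ultimately have "Q (push c) u" using Q_iff[OF push0 x(1)] c x(2) by simp
    moreover have "d = push c" if d: "Q d u" for d
    proof -
      have d0: "\<And>b. b \<notin> i ` B \<Longrightarrow> d b = \<zero>\<^bsub>R\<^esub>" using d by (simp add: Q_def)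
      then have "c = pull d" using Q_iff[OF d0 x(1)] d x(2) uniq by simp
      then show "d = push c"
        using d0 injB by (auto simp: push_def pull_def fun_eq_iff)
    qed
    ultimately show ?thesis by blast
  qed
  moreover have "i ` B \<subseteq> carrier N" using B im by auto
  ultimately have "is_basis R N (i ` B)" by (simp add: is_basis_def Q_def)
  then show ?thesis using N by (auto simp: free_module_def)
qed

theorem uS_semisimple_ring_imp_free:
  fixes M :: "('a, 'm) module" and i :: "'m \<Rightarrow> 'n"
  assumes S: "submonoid S R" and R: "uS_semisimple_ring TYPE('n) R S"
    and free: "free_module R M" and inj: "inj_on i (carrier M)"
  shows "uS_semisimple R S M"
proof -
  have M: "module R M" using free by (simp add: free_module_def)
  interpret M: module R M by fact
  define p where "p = inv_into (carrier M) i"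
  have p [simp]: "p (i x) = x" if "x \<in> carrier M" for x
    using inj that by (simp add: p_def)
  define N :: "('a, 'n) module" where "N = \<lparr>carrier = i ` carrier M, mult = undefined, one = undefined, zero = i \<zero>\<^bsub>M\<^esub>,
    add = (\<lambda>u v. i (p u \<oplus>\<^bsub>M\<^esub> p v)), smult = (\<lambda>a u. i (a \<odot>\<^bsub>M\<^esub> p u))\<rparr>"
  have N_simps: "carrier N = i ` carrier M" "\<zero>\<^bsub>N\<^esub> = i \<zero>\<^bsub>M\<^esub>"
    "\<And>u v. u \<oplus>\<^bsub>N\<^esub> v = i (p u \<oplus>\<^bsub>M\<^esub> p v)" "\<And>a u. a \<odot>\<^bsub>N\<^esub> u = i (a \<odot>\<^bsub>M\<^esub> p u)"
    by (simp_all add: N_def)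
  have N: "module R N"
  proof (intro moduleI abelian_groupI)
    show "cring R" ..
    fix u assume "u \<in> carrier N"
    then obtain x where x: "x \<in> carrier M" "u = i x" by (auto simp: N_simps)
    then show "\<exists>v\<in>carrier N. v \<oplus>\<^bsub>N\<^esub> u = \<zero>\<^bsub>N\<^esub>"
      by (intro bexI[of _ "i (\<ominus>\<^bsub>M\<^esub> x)"]) (auto simp: N_simps M.M.l_neg)
  qed (auto simp: N_simps M.smult_l_distr M.smult_r_distr M.smult_assoc1 M.M.a_ac)
  have i: "i \<in> module_hom R M N" by (auto simp: module_hom_def N_simps)
  have pN: "p \<in> module_hom R N M" by (auto simp: module_hom_def N_simps)
  have bij: "bij_betw i (carrier M) (carrier N)" using inj by (simp add: bij_betw_def N_simps)
  have "free_module R N" by (rule free_module_transfer[OF M N i bij free])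
  then have ssN: "uS_semisimple R S N" using R by (simp add: uS_semisimple_ring_def)
  show ?thesis unfolding uS_semisimple_def
  proof (intro conjI allI impI)
    fix A :: "('a, 'm) module" and f g and C :: "('a, 'm set) module"
    assume ex: "uS_short_exact R S A f M g C"
    have mods: "module R A" "module R C" and f: "f \<in> module_hom R A M" and g: "g \<in> module_hom R M C"
      using ex by (auto simp: uS_short_exact_def)
    have fM: "f x \<in> carrier M" if "x \<in> carrier A" for x using module_homD(1)[OF f that] .
    have f': "(\<lambda>x. i (f x)) \<in> module_hom R A N"
      using module_homD[OF f] module_homD[OF i] by (auto simp: module_hom_def)
    have g': "(\<lambda>u. g (p u)) \<in> module_hom R N C"
      using module_homD[OF pN] module_homD[OF g] by (auto simp: module_hom_def)
    have k1: "a_kernel A N (\<lambda>x. i (f x)) = a_kernel A M f"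
      using fM inj by (auto simp: a_kernel_def' N_simps dest: inj_onD)
    have im: "(\<lambda>u. g (p u)) ` carrier N = g ` carrier M" by (force simp: N_simps)
    have ck: "coker N C (\<lambda>u. g (p u)) = coker M C g" by (simp only: coker_def im)
    have k2: "a_kernel N C (\<lambda>u. g (p u)) = i ` a_kernel M C g"
    proof (intro equalityI subsetI)
      fix u assume "u \<in> a_kernel N C (\<lambda>u. g (p u))"
      then obtain x where "x \<in> carrier M" "u = i x" "g (p u) = \<zero>\<^bsub>C\<^esub>"
        unfolding a_kernel_def' N_simps by blast
      then show "u \<in> i ` a_kernel M C g" by (simp add: a_kernel_def')
    next
      fix u assume "u \<in> i ` a_kernel M C g"
      then obtain x where "x \<in> carrier M" "u = i x" "g x = \<zero>\<^bsub>C\<^esub>"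
        unfolding a_kernel_def' by blast
      then show "u \<in> a_kernel N C (\<lambda>u. g (p u))" by (simp add: a_kernel_def' N_simps)
    qed
    obtain s where s: "s \<in> S" "\<forall>x\<in>a_kernel A M f. s \<odot>\<^bsub>A\<^esub> x = \<zero>\<^bsub>A\<^esub>"
      "\<forall>X\<in>carrier (coker M C g). s \<odot>\<^bsub>coker M C g\<^esub> X = \<zero>\<^bsub>coker M C g\<^esub>"
      "(\<lambda>y. s \<odot>\<^bsub>M\<^esub> y) ` a_kernel M C g \<subseteq> f ` carrier A"
      "(\<lambda>y. s \<odot>\<^bsub>M\<^esub> y) ` (f ` carrier A) \<subseteq> a_kernel M C g"
      using ex unfolding uS_short_exact_def by (elim conjE bexE) (rule that)
    have smi: "s \<odot>\<^bsub>N\<^esub> i y = i (s \<odot>\<^bsub>M\<^esub> y)" if "y \<in> carrier M" for y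
      using that by (simp add: N_simps)
    have "(\<lambda>y. s \<odot>\<^bsub>N\<^esub> y) ` (i ` a_kernel M C g) \<subseteq> (\<lambda>x. i (f x)) ` carrier A"
    proof safe
      fix y assume y: "y \<in> a_kernel M C g"
      then have "y \<in> carrier M" by (simp add: a_kernel_def')
      moreover obtain x where "x \<in> carrier A" "s \<odot>\<^bsub>M\<^esub> y = f x" using s(4) y by blast
      ultimately show "s \<odot>\<^bsub>N\<^esub> i y \<in> (\<lambda>x. i (f x)) ` carrier A" by (auto simp: smi)
    qed
    moreover have "(\<lambda>y. s \<odot>\<^bsub>N\<^esub> y) ` ((\<lambda>x. i (f x)) ` carrier A) \<subseteq> i ` a_kernel M C g"
    proof safe
      fix x assume x: "x \<in> carrier A"
      then have "s \<odot>\<^bsub>M\<^esub> f x \<in> a_kernel M C g" using s(5) by blast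
      then show "s \<odot>\<^bsub>N\<^esub> i (f x) \<in> i ` a_kernel M C g" using fM[OF x] by (simp add: smi)
    qed
    ultimately have "uS_short_exact R S A (\<lambda>x. i (f x)) N (\<lambda>u. g (p u)) C"
      unfolding uS_short_exact_def k1 k2 ck
      by (intro conjI bexI[OF _ s(1)] mods N f' g' s(2,3))
    then have "uS_split R S A (\<lambda>x. i (f x)) N" by (rule uS_semisimple_imp_split[OF S ssN])
    then obtain t h where t: "t \<in> S" "h \<in> module_hom R N A"
      "\<And>x. x \<in> carrier A \<Longrightarrow> h (i (f x)) = t \<odot>\<^bsub>A\<^esub> x" unfolding uS_split_def by blast
    have "(\<lambda>x. h (i x)) \<in> module_hom R M A"
      using module_homD[OF t(2)] module_homD[OF i] by (auto simp: module_hom_def)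
    then show "uS_split R S A f M" unfolding uS_split_def
      using t(3) by (intro bexI[OF _ t(1)] bexI[of _ "\<lambda>x. h (i x)"]) auto
  qed (rule M)
qed

end

theory Submission
  imports Defs
begin

text \<open>
  Apply semisimplicity to a single free module: the one of finitely supported families in \<open>R\<close> whose
  index set contains all ideals \<open>I\<close> of \<open>R\<close>, with the submodule \<open>\<Oplus> I\<close> of those families whose component at \<open>I\<close> lies
  in \<open>I\<close>.  A retraction of it up to \<open>s \<in> S\<close> restricts to each component, so one and the same \<open>s\<close>
  serves all ideals: every ideal \<open>I\<close> contains an element \<open>e\<close> with \<open>xe = sx\<close> for all \<open>x \<in> I\<close>
  (\<open>uniform_relative_unit\<close>).  For \<open>s = 1\<close> this says that every ideal is generated by an idempotent.

  Now let \<open>I\<^sub>0 \<supseteq> I\<^sub>1 \<supseteq> \<dots>\<close> be a chain of ideals.  The annihilators of the \<open>I\<^sub>n\<close> increase, so their union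
  \<open>J\<close> is an ideal, and its element \<open>e\<close> with \<open>ye = sy\<close> on \<open>J\<close> already annihilates some \<open>I\<^sub>k\<close>.  If
  \<open>e\<^sub>n\<close> is the corresponding element of \<open>I\<^sub>n\<close>, then \<open>s - e\<^sub>n\<close> annihilates \<open>I\<^sub>n\<close>, hence lies in \<open>J\<close>,
  and therefore \<open>s(s - e\<^sub>n) = (s - e\<^sub>n)e\<close> annihilates \<open>I\<^sub>k\<close>.  Thus \<open>s\<^sup>2x = se\<^sub>nx \<in> I\<^sub>n\<close> for \<open>x \<in> I\<^sub>k\<close>, and
  \<open>s\<^sup>2\<close> is a constant that works for every chain (\<open>uS_Artinian_if_relative_units\<close>).
\<close>

section \<open>Submodules of semisimple modules are retracts up to S\<close>

text \<open>The sequence to split is \<open>0 \<rightarrow> N \<rightarrow> M \<rightarrow> M/N \<rightarrow> 0\<close>, which is exact in the ordinary sense,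
  so that \<open>\<one>\<close> witnesses its exactness.\<close>

lemma uS_semisimple_submodule_retraction:
  assumes S: "submonoid S R" and M: "uS_semisimple R S M" and N: "submodule N R M"
  shows "\<exists>s\<in>S. \<exists>h\<in>module_hom R M (M\<lparr>carrier := N\<rparr>). \<forall>x\<in>N. h x = s \<odot>\<^bsub>M\<^esub> x"
proof -
  interpret M: module R M using M by (simp add: uS_semisimple_def)
  interpret Q: module R "quot_module M N" by (rule M.module_quot[OF N])
  let ?N = "M\<lparr>carrier := N\<rparr>" and ?q = "\<lambda>x. N +>\<^bsub>M\<^esub> x"
  have modN: "module R ?N" by (rule submodule.submodule_is_module[OF N M.module_axioms])
  have NM: "N \<subseteq> carrier M" using M.submoduleE(1)[OF N] .
  have incl: "(\<lambda>x. x) \<in> module_hom R ?N M" using NM by (auto simp: module_hom_def)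
  have q: "?q \<in> module_hom R M (quot_module M N)" by (rule M.quot_map_hom[OF N])
  have one: "\<one>\<^bsub>R\<^esub> \<in> S" using S by (auto simp: submonoid_def)
  have ker: "a_kernel M (quot_module M N) ?q = N"
    using NM M.coset_eq_iff[OF N] by (auto simp: a_kernel_def' M.quot_zero)
  have coker: "\<forall>X\<in>carrier (coker M (quot_module M N) ?q).
      \<one>\<^bsub>R\<^esub> \<odot>\<^bsub>coker M (quot_module M N) ?q\<^esub> X = \<zero>\<^bsub>coker M (quot_module M N) ?q\<^esub>"
    unfolding Q.coker_annihilated_iff[OF M.module_axioms q M.R.one_closed]
    by (simp only: M.quot_carrier[symmetric]) (simp add: image_subset_iff)
  have "uS_short_exact R S ?N (\<lambda>x. x) M ?q (quot_module M N)"
    unfolding uS_short_exact_def ker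
    by (intro conjI bexI[OF _ one] modN M.module_axioms Q.module_axioms incl q coker)
       (use NM in \<open>auto simp: a_kernel_def'\<close>)
  then have "uS_split R S ?N (\<lambda>x. x) M" using M unfolding uS_semisimple_def by blast
  then show ?thesis by (simp add: uS_split_def)
qed


section \<open>The free module on an index type\<close>

definition finsupp_module :: "('a, 'r) ring_scheme \<Rightarrow> ('a, 'i \<Rightarrow> 'a) module"
  where "finsupp_module R =
    \<lparr>carrier = {x. (\<forall>i. x i \<in> carrier R) \<and> finite {i. x i \<noteq> \<zero>\<^bsub>R\<^esub>}},
     mult = undefined, one = undefined,
     zero = (\<lambda>i. \<zero>\<^bsub>R\<^esub>), add = (\<lambda>x y i. x i \<oplus>\<^bsub>R\<^esub> y i), smult = (\<lambda>a x i. a \<otimes>\<^bsub>R\<^esub> x i)\<rparr>"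

definition unit_vector :: "('a, 'r) ring_scheme \<Rightarrow> 'i \<Rightarrow> 'i \<Rightarrow> 'a"
  where "unit_vector R i = (\<lambda>j. if j = i then \<one>\<^bsub>R\<^esub> else \<zero>\<^bsub>R\<^esub>)"

lemma finsupp_module_simps:
  "x \<in> carrier (finsupp_module R) \<longleftrightarrow> (\<forall>i. x i \<in> carrier R) \<and> finite {i. x i \<noteq> \<zero>\<^bsub>R\<^esub>}"
  "\<zero>\<^bsub>finsupp_module R\<^esub> = (\<lambda>i. \<zero>\<^bsub>R\<^esub>)"
  "x \<oplus>\<^bsub>finsupp_module R\<^esub> y = (\<lambda>i. x i \<oplus>\<^bsub>R\<^esub> y i)"
  "a \<odot>\<^bsub>finsupp_module R\<^esub> x = (\<lambda>i. a \<otimes>\<^bsub>R\<^esub> x i)"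
  by (simp_all add: finsupp_module_def)

context cring
begin

lemma module_finsupp_module: "module R (finsupp_module R)"
proof (intro moduleI abelian_groupI)
  show "cring R" ..
  show "x \<oplus>\<^bsub>finsupp_module R\<^esub> y \<in> carrier (finsupp_module R)"
    if "x \<in> carrier (finsupp_module R)" "y \<in> carrier (finsupp_module R)" for x y
  proof -
    have "{i. x i \<oplus> y i \<noteq> \<zero>} \<subseteq> {i. x i \<noteq> \<zero>} \<union> {i. y i \<noteq> \<zero>}" by auto
    then show ?thesis using that by (auto simp: finsupp_module_simps intro: finite_subset)
  qed
  show "a \<odot>\<^bsub>finsupp_module R\<^esub> x \<in> carrier (finsupp_module R)"
    if "a \<in> carrier R" "x \<in> carrier (finsupp_module R)" for a x
  proof -
    have "{i. a \<otimes> x i \<noteq> \<zero>} \<subseteq> {i. x i \<noteq> \<zero>}" using that(1) by auto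
    then show ?thesis using that by (auto simp: finsupp_module_simps intro: finite_subset)
  qed
  show "\<exists>y\<in>carrier (finsupp_module R). y \<oplus>\<^bsub>finsupp_module R\<^esub> x = \<zero>\<^bsub>finsupp_module R\<^esub>"
    if "x \<in> carrier (finsupp_module R)" for x
  proof -
    have "{i. \<ominus> x i \<noteq> \<zero>} \<subseteq> {i. x i \<noteq> \<zero>}" by auto
    then show ?thesis using that
      by (intro bexI[of _ "\<lambda>i. \<ominus> x i"])
         (auto simp: finsupp_module_simps l_neg intro: finite_subset)
  qed
qed (auto simp: finsupp_module_simps fun_eq_iff a_ac m_assoc l_distr r_distr)

lemma unit_vector_closed: "unit_vector R i \<in> carrier (finsupp_module R)"
proof -
  have "{j. unit_vector R i j \<noteq> \<zero>} \<subseteq> {i}" by (auto simp: unit_vector_def)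
  then show ?thesis
    by (auto simp: finsupp_module_simps unit_vector_def intro: finite_subset)
qed

lemma finsum_finsupp_module_apply:
  assumes "finite F" "g \<in> F \<rightarrow> carrier (finsupp_module R)"
  shows "(\<Oplus>\<^bsub>finsupp_module R\<^esub>b\<in>F. g b) i = (\<Oplus>b\<in>F. g b i)"
proof -
  interpret M: module R "finsupp_module R" by (rule module_finsupp_module)
  show ?thesis
    using assms
  proof (induction F)
    case (insert b F)
    then have "(\<lambda>b. g b i) \<in> F \<rightarrow> carrier R" "g b i \<in> carrier R"
      by (auto simp: finsupp_module_simps Pi_def)
    then show ?case using insert by (simp add: finsupp_module_simps(3) Pi_def)
  qed (simp add: finsupp_module_simps)
qed

text \<open>The coefficient of a unit vector is the component of the sum at its index; this gives both
  existence and uniqueness of the expansion in unit vectors.  It also holds in the zero ring, where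
  all unit vectors coincide, because the support of \<open>c\<close> is then empty.\<close>

lemma unit_vector_combination_apply:
  fixes c :: "('i \<Rightarrow> 'a) \<Rightarrow> 'a" and i :: 'i
  assumes c: "c \<in> range (unit_vector R) \<rightarrow> carrier R"
    and c0: "\<And>b. b \<notin> range (unit_vector R) \<Longrightarrow> c b = \<zero>" and fin: "finite {b. c b \<noteq> \<zero>}"
  shows "(\<Oplus>\<^bsub>finsupp_module R\<^esub>b\<in>{b. c b \<noteq> \<zero>}. c b \<odot>\<^bsub>finsupp_module R\<^esub> b) i
    = c (unit_vector R i)"
proof -
  interpret M: module R "finsupp_module R" by (rule module_finsupp_module)
  let ?F = "{b. c b \<noteq> \<zero>}" and ?u = "unit_vector R i"
  have F: "b \<in> range (unit_vector R)" if "b \<in> ?F" for b using that c0 by blast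
  have cR: "c b \<in> carrier R" for b using c c0 by (cases "b \<in> range (unit_vector R)") auto
  have closed: "b \<in> carrier (finsupp_module R)" if "b \<in> ?F" for b
    using F[OF that] unit_vector_closed by auto
  have "(\<Oplus>\<^bsub>finsupp_module R\<^esub>b\<in>?F. c b \<odot>\<^bsub>finsupp_module R\<^esub> b) i = (\<Oplus>b\<in>?F. c b \<otimes> b i)"
    using fin cR closed M.smult_closed
    by (subst finsum_finsupp_module_apply) (auto simp: finsupp_module_simps(4)[symmetric],
      auto simp: finsupp_module_simps(4))
  also have "\<dots> = (\<Oplus>b\<in>?F. if ?u = b then c b else \<zero>)"
  proof (rule finsum_cong'[OF refl])
    show "(\<lambda>b. if ?u = b then c b else \<zero>) \<in> ?F \<rightarrow> carrier R" using cR by auto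
    fix b assume b: "b \<in> ?F"
    have nontrivial: "\<one> \<noteq> \<zero>" using b cR[of b] by (metis mem_Collect_eq r_null r_one)
    obtain j where "b = unit_vector R j" using F[OF b] by blast
    moreover have "j = i" if "?u = unit_vector R j"
      using fun_cong[OF that, of i] nontrivial by (auto simp: unit_vector_def split: if_splits)
    ultimately show "c b \<otimes> b i = (if ?u = b then c b else \<zero>)"
      using cR[of b] by (auto simp: unit_vector_def)
  qed
  also have "\<dots> = c ?u"
  proof (cases "?u \<in> ?F")
    case True
    then show ?thesis using fin cR by (intro finsum_singleton) auto
  next
    case False
    then have "(\<Oplus>b\<in>?F. if ?u = b then c b else \<zero>) = (\<Oplus>b\<in>?F. \<zero>)"
      by (intro finsum_cong') auto
    then show ?thesis using False by simp
  qed
  finally show ?thesis .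
qed

lemma is_basis_unit_vectors:
  "is_basis R (finsupp_module R) (range (unit_vector R :: 'i \<Rightarrow> _))"
  unfolding is_basis_def
proof (intro conjI ballI)
  let ?B = "range (unit_vector R :: 'i \<Rightarrow> _)" and ?M = "finsupp_module R"
  show "?B \<subseteq> carrier ?M" using unit_vector_closed by auto
  fix x :: "'i \<Rightarrow> 'a" assume x: "x \<in> carrier ?M"
  then have xR: "x i \<in> carrier R" for i by (simp add: finsupp_module_simps)
  let ?P = "\<lambda>c. c \<in> ?B \<rightarrow> carrier R \<and> (\<forall>b. b \<notin> ?B \<longrightarrow> c b = \<zero>) \<and>
    finite {b. c b \<noteq> \<zero>} \<and> x = (\<Oplus>\<^bsub>?M\<^esub>b\<in>{b. c b \<noteq> \<zero>}. c b \<odot>\<^bsub>?M\<^esub> b)"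
  define c where "c b = (if b \<in> ?B then x (inv_into UNIV (unit_vector R) b) else \<zero>)" for b
  have cu: "c (unit_vector R i) = x i" for i
  proof (cases "\<one> = \<zero>")
    case True
    then have "a = \<zero>" if "a \<in> carrier R" for a using that by (metis l_null l_one)
    then show ?thesis using xR by (metis c_def)
  next
    case False
    then have "inj (unit_vector R :: 'i \<Rightarrow> _)"
      by (intro injI) (metis unit_vector_def)
    then show ?thesis by (simp add: c_def)
  qed
  have "{b. c b \<noteq> \<zero>} \<subseteq> unit_vector R ` {i. x i \<noteq> \<zero>}"
    using cu by (auto simp: c_def split: if_splits)
  then have fin: "finite {b. c b \<noteq> \<zero>}"
    using x by (auto simp: finsupp_module_simps intro: finite_subset)
  have cB: "c \<in> ?B \<rightarrow> carrier R" using cu xR by auto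
  have c0: "c b = \<zero>" if "b \<notin> ?B" for b using that unfolding c_def by (rule if_not_P)
  show "\<exists>!c. ?P c"
  proof (rule ex1I)
    have "x = (\<Oplus>\<^bsub>?M\<^esub>b\<in>{b. c b \<noteq> \<zero>}. c b \<odot>\<^bsub>?M\<^esub> b)"
      using unit_vector_combination_apply[OF cB c0 fin] cu by (simp add: fun_eq_iff)
    then show "?P c" using cB c0 fin by blast
    fix d assume d: "?P d"
    then have "d (unit_vector R i) = x i" for i
      using unit_vector_combination_apply[of d i] by metis
    then have "d b = c b" if "b \<in> ?B" for b using that cu by force
    moreover have "d b = c b" if "b \<notin> ?B" for b using d c0[OF that] that by metis
    ultimately show "d = c" by blast
  qed
qed

lemma free_finsupp_module: "free_module R (finsupp_module R)"
  using module_finsupp_module is_basis_unit_vectors by (auto simp: free_module_def)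

lemma submodule_finsupp_ideals:
  assumes J: "\<And>i. ideal (J i) R"
  shows "submodule {x \<in> carrier (finsupp_module R). \<forall>i. x i \<in> J i} R (finsupp_module R)"
    (is "submodule ?N R ?M")
proof -
  interpret M: module R ?M by (rule module_finsupp_module)
  have sub: "additive_subgroup (J i) R" for i using J by (rule ideal.axioms)
  note smult_mem = ideal.I_l_closed[OF J]
  show ?thesis
  proof (rule M.submoduleI)
    show "\<zero>\<^bsub>?M\<^esub> \<in> ?N"
      using additive_subgroup.zero_closed[OF sub] M.zero_closed by (simp add: finsupp_module_simps(2))
    show smult: "a \<odot>\<^bsub>?M\<^esub> x \<in> ?N" if "a \<in> carrier R" "x \<in> ?N" for a x
      using that M.smult_closed[of a x] smult_mem by (simp add: finsupp_module_simps(4))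
    show "\<ominus>\<^bsub>?M\<^esub> x \<in> ?N" if "x \<in> ?N" for x
    proof -
      have "\<ominus>\<^bsub>?M\<^esub> x = (\<ominus> \<one>) \<odot>\<^bsub>?M\<^esub> x" using that M.smult_l_minus[of \<one> x] by simp
      then show ?thesis using smult[OF _ that, of "\<ominus> \<one>"] by simp
    qed
    show "x \<oplus>\<^bsub>?M\<^esub> y \<in> ?N" if "x \<in> ?N" "y \<in> ?N" for x y
      using that M.a_closed[of x y] additive_subgroup.a_closed[OF sub]
      by (simp add: finsupp_module_simps(3))
  qed auto
qed


section \<open>A relative unit in every ideal, for one constant\<close>

text \<open>The element \<open>e\<close> is the component at \<open>I\<close> of the image of the unit vector at \<open>I\<close>
  under a map into the sum of all ideals that is multiplication by \<open>s\<close> on that sum.  The index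
  type consists of all sets; at those that are not ideals the summand is the zero ideal.\<close>

lemma uniform_relative_unit:
  assumes S: "submonoid S R" and ss: "uS_semisimple_ring TYPE('a set \<Rightarrow> 'a) R S"
  shows "\<exists>s\<in>S. \<forall>I. ideal I R \<longrightarrow> (\<exists>e\<in>I. \<forall>x\<in>I. x \<otimes> e = s \<otimes> x)"
proof -
  let ?M = "finsupp_module R :: ('a, 'a set \<Rightarrow> 'a) module"
  interpret M: module R ?M by (rule module_finsupp_module)
  define J where "J I = (if ideal I R then I else {\<zero>})" for I
  have J: "ideal (J I) R" for I by (simp add: J_def zeroideal)
  let ?N = "{x \<in> carrier ?M. \<forall>I. x I \<in> J I}"
  have "uS_semisimple R S ?M"
    using ss by (simp add: uS_semisimple_ring_def free_finsupp_module)
  from uS_semisimple_submodule_retraction[OF S this submodule_finsupp_ideals[of J, OF J]]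
  obtain s h where s: "s \<in> S" and h: "h \<in> module_hom R ?M (?M\<lparr>carrier := ?N\<rparr>)"
    and hs: "\<And>x. x \<in> ?N \<Longrightarrow> h x = s \<odot>\<^bsub>?M\<^esub> x" by blast
  have sR: "s \<in> carrier R" using s S by (auto simp: submonoid_def)
  have "\<exists>e\<in>I. \<forall>x\<in>I. x \<otimes> e = s \<otimes> x" if I: "ideal I R" for I
  proof (intro bexI[of _ "h (unit_vector R I) I"] ballI)
    let ?u = "unit_vector R I"
    have JI: "J I = I" using I by (simp add: J_def)
    have "h ?u \<in> ?N" using module_homD(1)[OF h unit_vector_closed] by simp
    then show "h ?u I \<in> I" using JI by blast
    fix x assume x: "x \<in> I"
    have xR: "x \<in> carrier R" using ideal.Icarr[OF I x] .
    have "(x \<odot>\<^bsub>?M\<^esub> ?u) K \<in> J K" for K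
      using x xR JI additive_subgroup.zero_closed[OF ideal.axioms(1)[OF J], of K]
      by (auto simp: finsupp_module_simps(4) unit_vector_def)
    then have "x \<odot>\<^bsub>?M\<^esub> ?u \<in> ?N" using xR by (simp add: M.smult_closed unit_vector_closed)
    then have "s \<odot>\<^bsub>?M\<^esub> (x \<odot>\<^bsub>?M\<^esub> ?u) = h (x \<odot>\<^bsub>?M\<^esub> ?u)" by (simp only: hs)
    also have "\<dots> = x \<odot>\<^bsub>?M\<^esub> h ?u" using module_homD(3)[OF h xR unit_vector_closed] by simp
    finally have "(s \<odot>\<^bsub>?M\<^esub> (x \<odot>\<^bsub>?M\<^esub> ?u)) I = (x \<odot>\<^bsub>?M\<^esub> h ?u) I" by simp
    then show "x \<otimes> h ?u I = s \<otimes> x"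
      using xR sR by (simp add: finsupp_module_simps(4) unit_vector_def)
  qed
  then show ?thesis using s by blast
qed


section \<open>Descending chains of ideals\<close>

text \<open>The union is closed under addition because the annihilators increase along the chain.\<close>

lemma ideal_union_annihilators:
  assumes I: "\<And>n. I n \<subseteq> carrier R" and dec: "antimono I"
  shows "ideal {a \<in> carrier R. \<exists>n::nat. \<forall>x\<in>I n. a \<otimes> x = \<zero>} R" (is "ideal ?J R")
proof (intro idealI ring_axioms add.subgroupI)
  have mem: "x \<in> carrier R" if "x \<in> I n" for x n using that I by blast
  show "?J \<noteq> {}" using mem by (auto intro!: exI[of _ \<zero>])
  show "\<ominus> a \<in> ?J" if "a \<in> ?J" for a
    using that mem by (force simp: l_minus)
  show "a \<oplus> b \<in> ?J" if ab: "a \<in> ?J" "b \<in> ?J" for a b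
  proof -
    obtain m n where m: "\<forall>x\<in>I m. a \<otimes> x = \<zero>" and n: "\<forall>x\<in>I n. b \<otimes> x = \<zero>" using ab by blast
    have "I (max m n) \<subseteq> I m" "I (max m n) \<subseteq> I n"
      using antimonoD[OF dec] by simp_all
    then have "\<forall>x\<in>I (max m n). (a \<oplus> b) \<otimes> x = \<zero>"
      using ab m n mem by (auto simp: l_distr subset_iff)
    then show ?thesis using ab by blast
  qed
  show l: "r \<otimes> a \<in> ?J" if "a \<in> ?J" "r \<in> carrier R" for a r
    using that mem by (force simp: m_assoc)
  show "a \<otimes> r \<in> ?J" if "a \<in> ?J" "r \<in> carrier R" for a r
    using l[OF that] that by (simp add: m_comm)
qed auto

lemma uS_Artinian_if_relative_units:
  assumes S: "submonoid S R" and s: "s \<in> S"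
    and unit: "\<And>I. ideal I R \<Longrightarrow> \<exists>e\<in>I. \<forall>x\<in>I. x \<otimes> e = s \<otimes> x"
  shows "uS_Artinian R S"
  unfolding uS_Artinian_def
proof (intro bexI[of _ "s \<otimes> s"] allI impI)
  have sR: "s \<in> carrier R" using s S by (auto simp: submonoid_def)
  show "s \<otimes> s \<in> S" using S s by (auto simp: submonoid_def)
  fix I :: "nat \<Rightarrow> 'a set" assume chain: "\<forall>n. ideal (I n) R \<and> I (Suc n) \<subseteq> I n"
  then have I: "ideal (I n) R" for n by blast
  have dec: "antimono I" using chain by (auto simp: antimono_iff_le_Suc)
  have IR: "I n \<subseteq> carrier R" for n using ideal.Icarr[OF I] by blast
  let ?J = "{a \<in> carrier R. \<exists>n. \<forall>x\<in>I n. a \<otimes> x = \<zero>}"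
  obtain e where e: "e \<in> ?J" and eJ: "\<And>y. y \<in> ?J \<Longrightarrow> y \<otimes> e = s \<otimes> y"
    using unit[OF ideal_union_annihilators[OF IR dec]] by blast
  have eR: "e \<in> carrier R" using e by blast
  obtain k where k: "\<And>x. x \<in> I k \<Longrightarrow> e \<otimes> x = \<zero>" using e by blast
  have "(s \<otimes> s) \<otimes> x \<in> I n" if x: "x \<in> I k" for n x
  proof -
    have xR: "x \<in> carrier R" using x IR by blast
    obtain d where d: "d \<in> I n" and dI: "\<And>y. y \<in> I n \<Longrightarrow> y \<otimes> d = s \<otimes> y"
      using unit[OF I] by blast
    have dR: "d \<in> carrier R" using d IR by blast
    let ?f = "s \<ominus> d"
    have fR: "?f \<in> carrier R" using sR dR by simp
    have "?f \<otimes> y = \<zero>" if y: "y \<in> I n" for y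
    proof -
      have yR: "y \<in> carrier R" using y IR by blast
      have "?f \<otimes> y = s \<otimes> y \<ominus> y \<otimes> d"
        using sR dR yR m_comm[OF dR yR] by (simp add: minus_eq l_distr l_minus)
      then show ?thesis using dI[OF y] sR yR by (simp add: r_neg minus_eq)
    qed
    then have "?f \<in> ?J" using fR by blast
    then have "s \<otimes> ?f \<otimes> x = ?f \<otimes> (e \<otimes> x)"
      using eJ eR fR xR by (simp add: m_assoc[symmetric])
    then have "s \<otimes> ?f \<otimes> x = \<zero>" using k[OF x] fR by simp
    moreover have "s \<otimes> ?f \<otimes> x = (s \<otimes> s) \<otimes> x \<ominus> (s \<otimes> x) \<otimes> d"
      using sR dR xR by (simp add: minus_eq l_distr r_distr l_minus r_minus m_ac)
    ultimately have "(s \<otimes> s) \<otimes> x = (s \<otimes> x) \<otimes> d"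
      using sR dR xR minus_equality[of "(s \<otimes> s) \<otimes> x" "\<ominus> ((s \<otimes> x) \<otimes> d)"]
      by (simp add: minus_eq)
    then show ?thesis using ideal.I_l_closed[OF I d] sR xR by simp
  qed
  then show "\<exists>k. \<forall>n\<ge>k. (\<lambda>x. (s \<otimes> s) \<otimes> x) ` I k \<subseteq> I n" by blast
qed

end

theorem theorem3p7:
  fixes R :: "('a, 'r) ring_scheme" and S :: "'a set"
  assumes "cring R"
    and "submonoid S R"
    and "uS_semisimple_ring TYPE('a set \<Rightarrow> 'a) R S"
  shows "uS_Artinian R S"
proof -
  interpret cring R by fact
  show ?thesis
    using uniform_relative_unit[OF assms(2,3)] uS_Artinian_if_relative_units[OF assms(2)] by blast
qed

end
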